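(* For $y>0$ define the Hardy integral $$I(y):=\int_{0}^{\infty}\bigl(\psi(t+1)-\log(t)\bigr)e^{-yt^2}\,dt.$$ Let $c_1=0.952894$ and $c_2=1.56624$. Then for every $y>0$, $$\frac{2c_1^2\sqrt{y}}{\sqrt{\pi}\,\operatorname{erfi}(\sqrt{y})}-\frac{\operatorname{Ei}(-y)}{4}-\frac{e^{-y}}{12}+\frac{\sqrt{y\pi}}{12}\operatorname{erfc}(\sqrt{y})\le I(y),$$ and furthermore $$I(y)\le \sqrt{c_2\sqrt{\frac{\pi}{2y}}\,\operatorname{erf}(\sqrt{2y})}-\frac{\operatorname{Ei}(-y)}{4}.$$
   Context: $\Gamma$ is the gamma function and $\psi(x)=\frac{d}{dx}\log\Gamma(x)$ is the digamma function. The error function is $\operatorname{erf}(x)=\frac{2}{\sqrt{\pi}}\int_{0}^{x}e^{-t^2}dt$, with $\operatorname{erfc}(x)=1-\operatorname{erf}(x)$ and $\operatorname{erfi}(x)=-i\operatorname{erf}(ix)=\frac{2}{\sqrt{\pi}}\int_0^x e^{t^2}dt$. The exponential integral is $\operatorname{Ei}(x)=-\int_{-x}^{\infty}\frac{e^{-t}}{t}dt$, so that $\operatorname{Ei}(-y)=-\int_y^\infty \frac{e^{-t}}{t}dt$ for $y>0$. The constants $c_1$ and $c_2$ are the paper's numerical values for $\int_{0}^{1}\sqrt{\psi(t+1)-\log(t)}\,dt$ and $\int_{0}^{1}(\psi(t+1)-\log(t))^2dt$ respectively. *)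

theory Defs
  imports "HOL-Analysis.Analysis"
begin

text \<open>
  All integrals are (signed) Lebesgue interval integrals over the open interval, so the value of
  an integrand at the endpoint \<open>0\<close> is irrelevant.
\<close>

definition erf :: "real \<Rightarrow> real" where
  "erf x = 2 / sqrt pi * (LBINT t=0..x. exp (- (t\<^sup>2)))"

definition erfc :: "real \<Rightarrow> real" where
  "erfc x = 1 - erf x"

definition erfi :: "real \<Rightarrow> real" where
  "erfi x = 2 / sqrt pi * (LBINT t=0..x. exp (t\<^sup>2))"

text \<open>
  The exponential integral. Only meaningful for \<open>x < 0\<close>: for \<open>x > 0\<close> the classical value is a
  Cauchy principal value, which the Lebesgue integral does not provide.
\<close>

definition Ei :: "real \<Rightarrow> real" where
  "Ei x = - (LBINT t=-x..\<infinity>. exp (- t) / t)"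

definition hardy_integral :: "real \<Rightarrow> real" where
  "hardy_integral y = (LBINT t=0..\<infinity>. (Digamma (t + 1) - ln t) * exp (- y * t\<^sup>2))"

end

theory Submission
  imports Defs "HOL-Probability.Distributions"
begin

text \<open>
  Write \<open>f t = \<psi>(t + 1) - ln t\<close> (\<open>digamma_gap\<close> below). Telescoping the limit formula for \<open>\<psi>\<close> gives
  \<open>f t = (\<Sum>n. d (t + n))\<close> with \<open>d x = ln (1 + 1 / x) - 1 / (x + 1)\<close>. Since \<open>d\<close> is nonnegative and
  decreasing, so is \<open>f\<close>; and since \<open>d x\<close> is the difference between the integral of \<open>1 / s\<close> over
  \<open>[x, x + 1]\<close> and its right end value, the error estimates of the trapezoidal rule, summed over \<open>n\<close>,
  give \<open>1 / (2 t) - 1 / (12 t\<^sup>2) \<le> f t \<le> 1 / (2 t)\<close>.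
  
  The Hardy integral is split at \<open>t = 1\<close>. On the tail the bounds for \<open>f\<close> are integrated against
  \<open>exp (- y t\<^sup>2)\<close>: the substitution \<open>s = y t\<^sup>2\<close> turns the term \<open>1 / (2 t)\<close> into \<open>- Ei (- y) / 4\<close>, and an
  integration by parts turns the term \<open>1 / (12 t\<^sup>2)\<close> into the \<open>exp\<close> and \<open>erfc\<close> terms.
  
  On the head \<open>(0, 1)\<close> the integral of \<open>f\<close> is exactly \<open>1\<close>, because \<open>ln_Gamma (t + 1) - t ln t + t\<close> is an
  antiderivative. As \<open>f\<close> and \<open>exp (- y t\<^sup>2)\<close> both decrease, Chebyshev's integral inequality bounds the
  head from below by the integral of \<open>exp (- y t\<^sup>2)\<close>. By the Cauchy--Schwarz inequality the latter is
  at least the reciprocal of the integral of \<open>exp (y t\<^sup>2)\<close>, which \<open>erfi\<close> expresses; the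
  lower bound follows since \<open>c1\<^sup>2 \<le> 1\<close>. From above, the Cauchy--Schwarz inequality bounds the square of
  the head by the product of the integrals of \<open>f\<^sup>2\<close> and of \<open>exp (- 2 y t\<^sup>2)\<close>. The second factor is an
  \<open>erf\<close> value, and the first one is at most \<open>2 c2\<close>, since \<open>f t \<le> \<psi>(2) - ln t\<close> on \<open>(0, 1)\<close>
  and the square of the right-hand side has an elementary integral.
\<close>

section \<open>The difference between the digamma function and the logarithm\<close>

definition digamma_gap :: "real \<Rightarrow> real" where
  "digamma_gap t = Digamma (t + 1) - ln t"

definition gap_term :: "real \<Rightarrow> real" where
  "gap_term x = ln (x + 1) - ln x - 1 / (x + 1)"

text \<open>
  The logarithms telescope, so a partial sum is the sequence that converges to \<open>\<psi>(t + 1)\<close>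
  up to \<open>- ln t\<close> and an error \<open>ln (t + m) - ln m\<close>, which vanishes in the limit.
\<close>

lemma gap_term_sums:
  assumes "t > 0"
  shows "(\<lambda>n. gap_term (t + real n)) sums digamma_gap t"
proof -
  have partial: "(\<Sum>n<m. gap_term (t + real n))
      = ln (t + real m) - ln t - (\<Sum>n<m. inverse (t + 1 + real n))" for m
    by (induction m) (auto simp: gap_term_def inverse_eq_divide add_ac)
  have "(\<lambda>m. (ln (real m) - (\<Sum>n<m. inverse (t + 1 + real n)))
          + (ln (t + real m) - ln (real m)) - ln t) \<longlonglongrightarrow> Digamma (t + 1) + 0 - ln t"
  proof (intro tendsto_intros)
    show "(\<lambda>m. ln (real m) - (\<Sum>n<m. inverse (t + 1 + real n))) \<longlonglongrightarrow> Digamma (t + 1)"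
      using Digamma_LIMSEQ[of "t + 1"] assms by simp
    show "(\<lambda>m. ln (t + real m) - ln (real m)) \<longlonglongrightarrow> 0"
      by real_asymp
  qed
  then show ?thesis
    by (simp add: sums_def partial digamma_gap_def algebra_simps)
qed

text \<open>
  The derivative collapses to \<open>- 1 / (z (z + 1)\<^sup>2)\<close>.
\<close>

lemma gap_term_antimono:
  assumes "0 < x" "x \<le> y"
  shows "gap_term y \<le> gap_term x"
proof (rule DERIV_nonpos_imp_nonincreasing[OF assms(2)])
  fix z assume "x \<le> z" "z \<le> y"
  with assms have z: "z > 0" by simp
  have "(gap_term has_real_derivative (1 / (z + 1) - 1 / z + 1 / (z + 1)\<^sup>2)) (at z)"
    unfolding gap_term_def [abs_def]
    using z by (auto intro!: derivative_eq_intros simp: power2_eq_square)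
  moreover have "1 / (z + 1) - 1 / z + 1 / (z + 1)\<^sup>2 = - 1 / (z * (z + 1)\<^sup>2)"
    using z by (simp add: divide_simps) (simp add: power2_eq_square algebra_simps)
  ultimately show "\<exists>d. (gap_term has_real_derivative d) (at z) \<and> d \<le> 0"
    using z by auto
qed

text \<open>
  The chord of a convex function lies above it, so the trapezoidal rule overestimates the integral
  of \<open>1 / s\<close> over \<open>[x, x + 1]\<close>. The bound is written as a difference so that it telescopes.
\<close>

lemma gap_term_le:
  assumes "x > 0"
  shows "gap_term x \<le> (1 / x - 1 / (x + 1)) / 2"
  using ln_inverse_approx_le[OF assms, of 1]
  by (simp add: gap_term_def inverse_eq_divide field_simps)

text \<open>
  The correction is the first one in the Euler--Maclaurin formula for \<open>1 / s\<close>. The difference \<open>h\<close> of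
  the two sides vanishes at infinity, so it suffices that it decreases. In terms of \<open>a = 1 / z\<close> and
  \<open>b = 1 / (z + 1)\<close>, which satisfy \<open>a - b = a b\<close>, its derivative is \<open>- (a - b)\<^sup>3 / 6\<close>.
\<close>

lemma gap_term_ge:
  assumes "x > 0"
  shows "(1 / x - 1 / (x + 1)) / 2 - (1 / x\<^sup>2 - 1 / (x + 1)\<^sup>2) / 12 \<le> gap_term x"
proof -
  define h where "h = (\<lambda>x::real. ln (x + 1) - ln x - (inverse x + inverse (x + 1)) / 2
                          + ((inverse x)\<^sup>2 - (inverse (x + 1))\<^sup>2) / 12)"
  have "0 < h x"
  proof (rule DERIV_neg_imp_decreasing_at_top [where f = h and b = x])
    fix z assume "z \<ge> x"
    with assms have z: "z > 0" by simp
    define a b where "a = inverse z" and "b = inverse (z + 1)"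
    have ab: "a - b = a * b"
      using z by (simp add: a_def b_def field_simps)
    have "a * b > 0"
      using z by (simp add: a_def b_def)
    have "(h has_real_derivative (b - a + (a\<^sup>2 + b\<^sup>2) / 2 - (a ^ 3 - b ^ 3) / 6)) (at z)"
      unfolding h_def a_def b_def using z
      by (auto intro!: derivative_eq_intros)
         (simp add: power2_eq_square power3_eq_cube inverse_eq_divide [symmetric] add_divide_distrib diff_divide_distrib algebra_simps)
    moreover have "b - a + (a\<^sup>2 + b\<^sup>2) / 2 - (a ^ 3 - b ^ 3) / 6 = - ((a - b) ^ 3) / 6"
      using ab by algebra
    moreover have "(a - b) ^ 3 > 0"
      using \<open>a * b > 0\<close> by (simp add: ab)
    ultimately show "\<exists>d. (h has_real_derivative d) (at z) \<and> d < 0"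
      by force
  next
    show "(h \<longlongrightarrow> 0) at_top"
      unfolding h_def by real_asymp
  qed
  moreover have "0 < l - (a + b) / 2 + (c - d) / 12 \<Longrightarrow> (a - b) / 2 - (c - d) / 12 \<le> l - b"
    for a b c d l :: real
    by (simp add: field_simps)
  ultimately show ?thesis
    unfolding h_def gap_term_def inverse_eq_divide power_one_over by blast
qed

lemma telescope_inverse_sums:
  fixes t :: real
  assumes "t > 0" "k > 0"
  shows "(\<lambda>n. 1 / (t + real n) ^ k - 1 / (t + real n + 1) ^ k) sums (1 / t ^ k)"
proof -
  have "(\<lambda>n. 1 / (t + real n) ^ k) \<longlonglongrightarrow> 0"
  proof -
    have "(\<lambda>n. 1 / (t + real n)) \<longlonglongrightarrow> 0" by real_asymp
    then have "(\<lambda>n. (1 / (t + real n)) ^ k) \<longlonglongrightarrow> 0 ^ k" by (rule tendsto_power)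
    then show ?thesis using assms by (simp add: power_divide zero_power)
  qed
  from telescope_sums'[OF this] show ?thesis
    by (simp add: add_ac)
qed

lemma digamma_gap_antimono:
  assumes "0 < s" "s \<le> t"
  shows "digamma_gap t \<le> digamma_gap s"
  using assms
  by (intro sums_le[OF _ gap_term_sums gap_term_sums] gap_term_antimono) auto

lemma digamma_gap_le:
  assumes "t > 0"
  shows "digamma_gap t \<le> 1 / (2 * t)"
proof -
  have "(\<lambda>n. (1 / (t + real n) - 1 / (t + real n + 1)) / 2) sums (1 / t / 2)"
    using telescope_inverse_sums[OF assms, of 1] by (intro sums_divide) simp
  with gap_term_sums[OF assms] have "digamma_gap t \<le> 1 / t / 2"
    by (rule sums_le[rotated]) (use assms in \<open>intro gap_term_le, simp\<close>)
  then show ?thesis by (simp add: mult.commute)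
qed

lemma digamma_gap_ge:
  assumes "t > 0"
  shows "1 / (2 * t) - 1 / (12 * t\<^sup>2) \<le> digamma_gap t"
proof -
  have "(\<lambda>n. (1 / (t + real n) - 1 / (t + real n + 1)) / 2
              - (1 / (t + real n)\<^sup>2 - 1 / (t + real n + 1)\<^sup>2) / 12) sums (1 / t / 2 - 1 / t\<^sup>2 / 12)"
    using telescope_inverse_sums[OF assms, of 1] telescope_inverse_sums[OF assms, of 2]
    by (intro sums_diff sums_divide) simp_all
  from this gap_term_sums[OF assms] have "1 / t / 2 - 1 / t\<^sup>2 / 12 \<le> digamma_gap t"
    by (rule sums_le[rotated]) (use assms in \<open>intro gap_term_ge, simp\<close>)
  then show ?thesis by (simp add: mult.commute)
qed

lemma digamma_gap_nonneg:
  assumes "t > 0"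
  shows "0 \<le> digamma_gap t"
proof -
  have "0 \<le> gap_term x" if "x > 0" for x
  proof (rule tendsto_upperbound)
    show "(gap_term \<longlongrightarrow> 0) at_top"
      unfolding gap_term_def [abs_def] by real_asymp
    show "\<forall>\<^sub>F z in at_top. gap_term z \<le> gap_term x"
      using eventually_ge_at_top[of x] by eventually_elim (use that in \<open>simp add: gap_term_antimono\<close>)
  qed simp
  then show ?thesis
    using sums_le[OF _ sums_zero gap_term_sums[OF assms]] assms by auto
qed

text \<open>
  By monotonicity \<open>\<psi>(t + 1) \<le> \<psi>(2) = 1 - \<gamma>\<close>, and the constant is \<open>1 - 19 / 33\<close>.
\<close>

lemma digamma_gap_le_log:
  assumes "0 < t" "t \<le> 1"
  shows "digamma_gap t \<le> 14 / 33 - ln t"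
proof -
  have "Digamma (t + 1) \<le> Digamma (2 :: real)"
    using assms by (intro Digamma_real_mono) auto
  also have "\<dots> = 1 - euler_mascheroni"
    by (simp add: Digamma_numeral harm_expand)
  finally show ?thesis
    using euler_mascheroni_gt_19_over_33 by (simp add: digamma_gap_def)
qed

lemma isCont_digamma_gap: "t > 0 \<Longrightarrow> isCont digamma_gap t"
  unfolding digamma_gap_def [abs_def]
  by (intro continuous_intros) (auto simp: nonpos_Ints_def)

lemma continuous_on_digamma_gap: "A \<subseteq> {0<..} \<Longrightarrow> continuous_on A digamma_gap"
  by (intro continuous_at_imp_continuous_on) (auto intro!: isCont_digamma_gap)

section \<open>Two integral inequalities\<close>

lemma cauchy_schwarz_set_integral:
  fixes f g :: "'a \<Rightarrow> real"
  assumes ff: "set_integrable M A (\<lambda>x. (f x)\<^sup>2)" and gg: "set_integrable M A (\<lambda>x. (g x)\<^sup>2)"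
    and fg: "set_integrable M A (\<lambda>x. f x * g x)"
  shows "(LINT x:A|M. f x * g x)\<^sup>2 \<le> (LINT x:A|M. (f x)\<^sup>2) * (LINT x:A|M. (g x)\<^sup>2)"
proof -
  define P Q R where "P = (LINT x:A|M. (f x)\<^sup>2)" and "Q = (LINT x:A|M. (g x)\<^sup>2)"
    and "R = (LINT x:A|M. f x * g x)"
  have quad: "0 \<le> u\<^sup>2 * P + 2 * (u * v) * R + v\<^sup>2 * Q" for u v :: real
  proof -
    have "0 \<le> (LINT x:A|M. (u * f x + v * g x)\<^sup>2)"
      by (simp add: set_lebesgue_integral_def)
    also have "\<dots> = (LINT x:A|M. (u\<^sup>2 * (f x)\<^sup>2 + 2 * (u * v) * (f x * g x)) + v\<^sup>2 * (g x)\<^sup>2)"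
      by (simp add: power2_eq_square algebra_simps)
    also have "\<dots> = u\<^sup>2 * P + 2 * (u * v) * R + v\<^sup>2 * Q"
      using assms by (simp add: P_def Q_def R_def)
    finally show ?thesis .
  qed
  have "P \<ge> 0" "Q \<ge> 0"
    using quad[of 1 0] quad[of 0 1] by auto
  have "R\<^sup>2 \<le> P * Q"
  proof (cases "Q = 0")
    case True
    then have "R = 0"
    proof -
      \<comment> \<open>For \<open>Q = 0\<close> the form takes the value \<open>- R\<^sup>2 (P + 2)\<close> at this point.\<close>
      have "R\<^sup>2 * (P + 2) \<le> 0"
        using quad[of R "- (P + 1)"] True by (simp add: power2_eq_square algebra_simps)
      moreover have "P + 2 > 0" using \<open>P \<ge> 0\<close> by simp
      ultimately show "R = 0" by (simp add: mult_le_0_iff)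
    qed
    then show ?thesis using True by simp
  next
    case False
    then have "Q > 0" using \<open>Q \<ge> 0\<close> by simp
    have "0 \<le> Q * (P * Q - R\<^sup>2)"
      using quad[of Q "-R"] by (simp add: power2_eq_square algebra_simps)
    then show ?thesis using \<open>Q > 0\<close> by (simp add: zero_le_mult_iff)
  qed
  then show ?thesis by (simp add: P_def Q_def R_def)
qed

lemma set_integrable_unit_interval:
  fixes f :: "real \<Rightarrow> real"
  assumes "continuous_on {0..1} f"
  shows "set_integrable lborel {0<..<1} f"
  by (rule set_integrable_subset[OF borel_integrable_atLeastAtMost'[OF assms]]) auto

text \<open>
  Let \<open>m\<close> be the mean of \<open>f\<close> and \<open>p\<close> the point where the decreasing function \<open>f\<close> crosses the level \<open>m\<close>.
  Then \<open>f - m\<close> and \<open>g - g p\<close> change sign at the same point \<open>p\<close> and in the same direction, so their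
  product is nonnegative. Integrating it gives the claim, because \<open>f - m\<close> has mean zero. The second
  function is required to be monotone on the closed interval because \<open>p\<close> can be an end point.
\<close>

lemma chebyshev_unit_interval:
  fixes f g :: "real \<Rightarrow> real"
  assumes f: "antimono_on {0<..<1} f" and g: "antimono_on {0..1} g"
    and int: "set_integrable lborel {0<..<1} f" "set_integrable lborel {0<..<1} g"
      "set_integrable lborel {0<..<1} (\<lambda>t. f t * g t)"
  shows "(LBINT t:{0<..<1}. f t) * (LBINT t:{0<..<1}. g t) \<le> (LBINT t:{0<..<1}. f t * g t)"
proof -
  define m where "m = (LBINT t:{0<..<1}. f t)"
  \<comment> \<open>Inserting \<open>0\<close> makes \<open>S\<close> nonempty without a proof that \<open>f\<close> reaches its mean.\<close>
  define S where "S = insert 0 {t \<in> {0<..<1}. m \<le> f t}"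
  define p where "p = Sup S"
  have bdd: "bdd_above S"
    unfolding S_def by (auto intro!: bdd_aboveI[of _ 1])
  have p: "p \<in> {0..1}"
    using bdd cSup_upper[of 0 S] by (auto simp: p_def S_def intro!: cSup_least)
  have below: "m \<le> f t" if "t \<in> {0<..<1}" "t < p" for t
  proof -
    obtain s where "s \<in> S" "t < s"
      using \<open>t < p\<close> less_cSupD[of S t] by (auto simp: p_def S_def)
    then have "m \<le> f s" "s \<in> {0<..<1}"
      using that by (auto simp: S_def)
    then show ?thesis
      using monotone_onD[OF f that(1) \<open>s \<in> {0<..<1}\<close>] \<open>t < s\<close> by simp
  qed
  have above: "f t \<le> m" if "t \<in> {0<..<1}" "p < t" for t
    using that cSup_upper[OF _ bdd, of t] by (force simp: p_def S_def)
  have "0 \<le> (f t - m) * (g t - g p)" if t: "t \<in> {0<..<1}" for t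
  proof (cases t p rule: linorder_cases)
    case less
    then show ?thesis
      using below[OF t] monotone_onD[OF g, of t p] t p by simp
  next
    case greater
    then show ?thesis
      using above[OF t] monotone_onD[OF g, of p t] t p by (simp add: mult_nonpos_nonpos)
  qed simp
  then have "0 \<le> (LBINT t:{0<..<1}. (f t - m) * (g t - g p))"
    unfolding set_lebesgue_integral_def
    by (intro integral_nonneg_AE) (auto split: split_indicator)
  also have "\<dots> = (LBINT t:{0<..<1}. (f t * g t - m * g t) - (g p * f t - m * g p))"
    by (simp add: algebra_simps)
  also have "\<dots> = (LBINT t:{0<..<1}. f t * g t) - m * (LBINT t:{0<..<1}. g t)"
  proof -
    have const: "set_integrable lborel {0<..<1::real} (\<lambda>_. m * g p)"
      "(LBINT t:{0<..<1::real}. m * g p) = m * g p"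
      by (auto simp: set_integrable_unit_interval set_integral_const)
    then show ?thesis
      using int by (simp add: m_def)
  qed
  finally show ?thesis by (simp add: m_def)
qed

section \<open>Gaussian integrals on the unit interval and on its complement\<close>

lemma LBINT_01: "(LBINT t=0..1. f t) = (LBINT t:{0<..<1::real}. (f t :: real))"
  by (simp add: interval_lebesgue_integral_def zero_ereal_def one_ereal_def)

lemma LBINT_1_infty: "(LBINT t=1..\<infinity>. f t) = (LBINT t:{(1::real)<..}. (f t :: real))"
  by (simp add: interval_lebesgue_integral_def one_ereal_def)

lemma scaled_unit_interval_integral:
  fixes f :: "real \<Rightarrow> real"
  assumes "continuous_on UNIV f" "c \<ge> 0"
  shows "(LBINT s=0..c. f s) = c * (LBINT t:{0<..<1}. f (c * t))"
proof -
  have "(LBINT t=ereal 0..ereal 1. c *\<^sub>R f (c * t)) = (LBINT s=c * 0..c * 1. f s)"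
    using assms
    by (intro interval_integral_substitution_finite)
       (auto intro!: derivative_eq_intros continuous_intros continuous_on_subset[OF assms(1)])
  then show ?thesis
    by (simp add: zero_ereal_def [symmetric] one_ereal_def [symmetric] LBINT_01)
qed

lemma erf_sqrt:
  assumes "a \<ge> 0"
  shows "erf (sqrt a) = 2 / sqrt pi * sqrt a * (LBINT t:{0<..<1}. exp (- a * t\<^sup>2))"
  using scaled_unit_interval_integral[of "\<lambda>s. exp (- (s\<^sup>2))" "sqrt a"] assms
  by (simp add: erf_def power_mult_distrib continuous_intros)

lemma erfi_sqrt:
  assumes "a \<ge> 0"
  shows "erfi (sqrt a) = 2 / sqrt pi * sqrt a * (LBINT t:{0<..<1}. exp (a * t\<^sup>2))"
  using scaled_unit_interval_integral[of "\<lambda>s. exp (s\<^sup>2)" "sqrt a"] assms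
  by (simp add: erfi_def power_mult_distrib continuous_intros)

lemma gaussian_half_line:
  assumes "a > (0::real)"
  shows "set_integrable lborel {0..} (\<lambda>t. exp (- a * t\<^sup>2))"
    and "(LBINT t:{0..}. exp (- a * t\<^sup>2)) = sqrt (pi / a) / 2"
proof -
  have "has_bochner_integral lborel
          (\<lambda>x. indicator {0..} (0 + sqrt a * x) *\<^sub>R exp (- (0 + sqrt a * x)\<^sup>2)) ((sqrt pi / 2) /\<^sub>R \<bar>sqrt a\<bar>)"
    using gaussian_moment_0 assms
    by (subst (asm) lborel_has_bochner_integral_real_affine_iff[of "sqrt a" _ _ 0]) auto
  moreover have "(\<lambda>x. indicator {0..} (0 + sqrt a * x) *\<^sub>R exp (- (0 + sqrt a * x)\<^sup>2))
      = (\<lambda>x. indicator {0..} x *\<^sub>R exp (- a * x\<^sup>2))"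
    using assms by (auto simp: fun_eq_iff indicator_def power_mult_distrib zero_le_mult_iff)
  ultimately have "has_bochner_integral lborel (\<lambda>x. indicator {0..} x *\<^sub>R exp (- a * x\<^sup>2)) (sqrt (pi / a) / 2)"
    using assms by (simp add: real_sqrt_divide field_simps)
  then show "set_integrable lborel {0..} (\<lambda>t. exp (- a * t\<^sup>2))"
    and "(LBINT t:{0..}. exp (- a * t\<^sup>2)) = sqrt (pi / a) / 2"
    unfolding set_integrable_def set_lebesgue_integral_def has_bochner_integral_iff by auto
qed

lemma set_integral_split_at_1:
  fixes f :: "real \<Rightarrow> real"
  assumes "set_integrable lborel {0<..} f"
  shows "(LBINT t:{0<..}. f t) = (LBINT t:{0<..<1}. f t) + (LBINT t:{1<..}. f t)"
proof -
  have "interval_lebesgue_integrable lborel (min 0 (min 1 \<infinity>)) (max 0 (max 1 \<infinity>)) f"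
    using assms by (simp add: interval_lebesgue_integral_0_infty)
  from interval_integral_sum[OF this] show ?thesis
    by (simp add: LBINT_01 LBINT_1_infty interval_lebesgue_integral_0_infty)
qed

lemma gaussian_tail:
  assumes "y > (0::real)"
  shows "(LBINT t:{1<..}. exp (- y * t\<^sup>2)) = sqrt (pi / y) / 2 * erfc (sqrt y)"
proof -
  have int: "set_integrable lborel {0<..} (\<lambda>t. exp (- y * t\<^sup>2))"
    by (rule set_integrable_subset[OF gaussian_half_line(1)[OF assms]]) auto
  have "(LBINT t:{0<..}. exp (- y * t\<^sup>2)) = (LBINT t:{0..}. exp (- y * t\<^sup>2))"
    by (rule set_integral_discrete_difference[of "{0}"]) auto
  also note gaussian_half_line(2)[OF assms]
  finally have "(LBINT t:{1<..}. exp (- y * t\<^sup>2))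
      = sqrt (pi / y) / 2 - (LBINT t:{0<..<1}. exp (- y * t\<^sup>2))"
    using set_integral_split_at_1[OF int] by simp
  moreover have "sqrt (pi / y) / 2 * erf (sqrt y) = (LBINT t:{0<..<1}. exp (- y * t\<^sup>2))"
    using assms by (simp add: erf_sqrt real_sqrt_divide)
  ultimately show ?thesis
    by (simp add: erfc_def right_diff_distrib)
qed

text \<open>
  Integration by parts: the function \<open>- exp (- y t\<^sup>2) / t\<close> has the nonnegative derivative
  \<open>exp (- y t\<^sup>2) / t\<^sup>2 + 2 y exp (- y t\<^sup>2)\<close>, whose second summand integrates to an \<open>erfc\<close> value.
\<close>

lemma gaussian_over_square_tail:
  assumes "y > (0::real)"
  shows "set_integrable lborel {1<..} (\<lambda>t. exp (- y * t\<^sup>2) / t\<^sup>2)"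
    and "(LBINT t:{1<..}. exp (- y * t\<^sup>2) / t\<^sup>2) = exp (- y) - sqrt (y * pi) * erfc (sqrt y)"
proof -
  have G: "set_integrable lborel {1<..} (\<lambda>t. exp (- y * t\<^sup>2))"
    by (rule set_integrable_subset[OF gaussian_half_line(1)[OF assms]]) auto
  define F where "F = (\<lambda>t::real. - exp (- y * t\<^sup>2) / t)"
  define f where "f = (\<lambda>t::real. exp (- y * t\<^sup>2) / t\<^sup>2 + 2 * y * exp (- y * t\<^sup>2))"
  have deriv: "DERIV F t :> f t" if "1 < ereal t" for t
    unfolding F_def f_def using that
    by (auto intro!: derivative_eq_intros simp: power2_eq_square field_simps one_ereal_def)
  have cont: "isCont f t" if "1 < ereal t" for t
    unfolding f_def using that by (auto intro!: continuous_intros simp: one_ereal_def)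
  have lim1: "((F \<circ> real_of_ereal) \<longlongrightarrow> - exp (- y)) (at_right 1)"
  proof -
    have "isCont F 1" unfolding F_def by (intro continuous_intros) auto
    then have "(F \<longlongrightarrow> F 1) (at_right 1)"
      by (simp add: isCont_def tendsto_within_subset[of _ _ _ UNIV])
    then show ?thesis
      by (simp add: one_ereal_def ereal_tendsto_simps F_def)
  qed
  have lim2: "((F \<circ> real_of_ereal) \<longlongrightarrow> 0) (at_left \<infinity>)"
  proof -
    have "(F \<longlongrightarrow> 0) at_top" unfolding F_def using assms by real_asymp
    then show ?thesis by (simp add: ereal_tendsto_simps)
  qed
  have nonneg: "AE t in lborel. 1 < ereal t \<longrightarrow> ereal t < \<infinity> \<longrightarrow> 0 \<le> f t"
    using assms by (auto simp: f_def)
  have f: "set_integrable lborel {1<..} f" "(LBINT t:{1<..}. f t) = exp (- y)"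
    using interval_integral_FTC_nonneg[of 1 \<infinity> F f, OF _ deriv cont nonneg lim1 lim2]
    by (simp_all add: LBINT_1_infty) (simp add: one_ereal_def)
  have eq: "(\<lambda>t. exp (- y * t\<^sup>2) / t\<^sup>2) = (\<lambda>t. f t - 2 * y * exp (- y * t\<^sup>2))"
    by (simp add: f_def)
  show "set_integrable lborel {1<..} (\<lambda>t. exp (- y * t\<^sup>2) / t\<^sup>2)"
    unfolding eq using f(1) G by (intro set_integral_diff set_integrable_mult_right)
  have "(LBINT t:{1<..}. exp (- y * t\<^sup>2) / t\<^sup>2)
      = exp (- y) - 2 * y * (sqrt (pi / y) / 2 * erfc (sqrt y))"
    unfolding eq using f G gaussian_tail[OF assms] by (subst set_integral_diff) auto
  also have "2 * y * (sqrt (pi / y) / 2 * erfc (sqrt y)) = sqrt (y * pi) * erfc (sqrt y)"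
    using assms by (simp add: real_sqrt_divide real_sqrt_mult field_simps)
  finally show "(LBINT t:{1<..}. exp (- y * t\<^sup>2) / t\<^sup>2) = exp (- y) - sqrt (y * pi) * erfc (sqrt y)" .
qed

text \<open>
  The substitution \<open>s = y t\<^sup>2\<close> gives \<open>exp (- s) / s ds = 2 exp (- y t\<^sup>2) / t dt\<close>.
\<close>

lemma gaussian_over_t_tail:
  assumes "y > (0::real)"
  shows "set_integrable lborel {1<..} (\<lambda>t. exp (- y * t\<^sup>2) / t)"
    and "(LBINT t:{1<..}. exp (- y * t\<^sup>2) / t) = - Ei (- y) / 2"
proof -
  have G: "set_integrable lborel {1<..} (\<lambda>t. exp (- y * t\<^sup>2))"
    by (rule set_integrable_subset[OF gaussian_half_line(1)[OF assms]]) auto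
  have "set_borel_measurable lborel {1<..} (\<lambda>t. exp (- y * t\<^sup>2) / t)"
    unfolding set_borel_measurable_def by measurable
  then show int: "set_integrable lborel {1<..} (\<lambda>t. exp (- y * t\<^sup>2) / t)"
    by (rule set_integrable_bound[OF G]) (auto simp: field_simps)
  have eq: "exp (- (y * t\<^sup>2)) / (y * t\<^sup>2) * (2 * y * t) = 2 * (exp (- y * t\<^sup>2) / t)" for t
    using assms by (simp add: field_simps power2_eq_square)
  have lim1: "((ereal \<circ> (\<lambda>t. y * t\<^sup>2) \<circ> real_of_ereal) \<longlongrightarrow> y) (at_right 1)"
  proof -
    have "((\<lambda>t. y * t\<^sup>2) \<longlongrightarrow> y * 1\<^sup>2) (at_right 1)"
      by (intro tendsto_intros)
    then show ?thesis by (simp add: one_ereal_def ereal_tendsto_simps)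
  qed
  have lim2: "((ereal \<circ> (\<lambda>t. y * t\<^sup>2) \<circ> real_of_ereal) \<longlongrightarrow> \<infinity>) (at_left \<infinity>)"
  proof -
    have "LIM t at_top. y * t\<^sup>2 :> at_top" using assms by real_asymp
    then show ?thesis by (simp add: ereal_tendsto_simps)
  qed
  have "(LBINT s=y..\<infinity>. exp (- s) / s)
      = (LBINT t=1..\<infinity>. exp (- (y * t\<^sup>2)) / (y * t\<^sup>2) * (2 * y * t))"
  proof (rule interval_integral_substitution_nonneg(2)[OF _ _ _ _ _ _ lim1 lim2])
    have "einterval 1 \<infinity> = {1<..}"
      by (simp add: one_ereal_def)
    then show "set_integrable lborel (einterval 1 \<infinity>) (\<lambda>t. exp (- (y * t\<^sup>2)) / (y * t\<^sup>2) * (2 * y * t))"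
      unfolding eq using int by (simp only: set_integrable_mult_right)
  qed (use assms in \<open>auto simp: one_ereal_def intro!: derivative_eq_intros continuous_intros\<close>)
  also have "\<dots> = 2 * (LBINT t:{1<..}. exp (- y * t\<^sup>2) / t)"
    unfolding eq LBINT_1_infty by (rule set_integral_mult_right)
  finally show "(LBINT t:{1<..}. exp (- y * t\<^sup>2) / t) = - Ei (- y) / 2"
    by (simp add: Ei_def)
qed

section \<open>Moments of the digamma gap on the unit interval\<close>

text \<open>
  Since \<open>\<psi>\<close> is the derivative of \<open>ln_Gamma\<close>, an antiderivative is \<open>ln_Gamma (t + 1) - t ln t + t\<close>. It
  runs from \<open>0\<close> to \<open>1\<close>, as \<open>ln_Gamma\<close> vanishes at \<open>1\<close> and at \<open>2\<close>.
\<close>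

lemma digamma_gap_unit_integral:
  "set_integrable lborel {0<..<1} digamma_gap" "(LBINT t:{0<..<1}. digamma_gap t) = 1"
proof -
  define F where "F = (\<lambda>t::real. ln_Gamma (t + 1) + (- t * ln t + t))"
  have deriv: "DERIV F t :> digamma_gap t" if "0 < ereal t" for t
    unfolding F_def digamma_gap_def using that
    by (auto intro!: derivative_eq_intros simp: zero_ereal_def)
  have cont: "isCont digamma_gap t" if "0 < ereal t" for t
    using that by (simp add: isCont_digamma_gap zero_ereal_def)
  have ln_Gamma_1: "ln_Gamma (1::real) = 0" "ln_Gamma (2::real) = 0"
    using Gamma_fact[of 1, where 'a = real] by (simp_all add: ln_Gamma_real_pos numeral_2_eq_2)
  have lim0: "((F \<circ> real_of_ereal) \<longlongrightarrow> 0) (at_right 0)"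
  proof -
    have "isCont (\<lambda>t::real. ln_Gamma (t + 1)) 0"
      by (rule DERIV_isCont) (auto intro!: derivative_eq_intros)
    then have "((\<lambda>t::real. ln_Gamma (t + 1)) \<longlongrightarrow> 0) (at_right 0)"
      using ln_Gamma_1 by (simp add: isCont_def tendsto_within_subset[of _ _ _ UNIV])
    moreover have "((\<lambda>t::real. - t * ln t + t) \<longlongrightarrow> 0) (at_right 0)"
      by real_asymp
    ultimately have "((\<lambda>t::real. ln_Gamma (t + 1) + (- t * ln t + t)) \<longlongrightarrow> 0 + 0) (at_right 0)"
      by (rule tendsto_add)
    then show ?thesis
      by (simp add: zero_ereal_def ereal_tendsto_simps F_def)
  qed
  have lim1: "((F \<circ> real_of_ereal) \<longlongrightarrow> 1) (at_left 1)"
  proof -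
    have "isCont F 1"
      by (rule DERIV_isCont[OF deriv]) simp
    then have "(F \<longlongrightarrow> F 1) (at_left 1)"
      by (simp add: isCont_def tendsto_within_subset[of _ _ _ UNIV])
    then show ?thesis
      using ln_Gamma_1 by (simp add: one_ereal_def ereal_tendsto_simps F_def)
  qed
  have nonneg: "AE t in lborel. 0 < ereal t \<longrightarrow> ereal t < 1 \<longrightarrow> 0 \<le> digamma_gap t"
    by (simp add: digamma_gap_nonneg zero_ereal_def)
  note FTC = interval_integral_FTC_nonneg[of 0 1 F digamma_gap, OF _ deriv cont nonneg lim0 lim1]
  show "(LBINT t:{0<..<1}. digamma_gap t) = 1"
    using FTC(2) by (simp add: LBINT_01)
  show "set_integrable lborel {0<..<1} digamma_gap"
    using FTC(1) by (simp add: zero_ereal_def one_ereal_def)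
qed

lemma square_const_minus_ln_unit_integral:
  fixes a :: real
  shows "set_integrable lborel {0<..<1} (\<lambda>t. (a - ln t)\<^sup>2)"
    and "(LBINT t:{0<..<1}. (a - ln t)\<^sup>2) = a\<^sup>2 + 2 * a + 2"
proof -
  define F where "F = (\<lambda>t::real. t * ((a - ln t)\<^sup>2 + 2 * (a - ln t) + 2))"
  have deriv: "DERIV F t :> (a - ln t)\<^sup>2" if "0 < ereal t" for t
    unfolding F_def using that
    by (auto intro!: derivative_eq_intros simp: zero_ereal_def field_simps)
  have cont: "isCont (\<lambda>t. (a - ln t)\<^sup>2) t" if "0 < ereal t" for t
    using that by (auto intro!: continuous_intros simp: zero_ereal_def)
  have lim0: "((F \<circ> real_of_ereal) \<longlongrightarrow> 0) (at_right 0)"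
  proof -
    have "(F \<longlongrightarrow> 0) (at_right 0)" unfolding F_def by real_asymp
    then show ?thesis by (simp add: zero_ereal_def ereal_tendsto_simps)
  qed
  have lim1: "((F \<circ> real_of_ereal) \<longlongrightarrow> a\<^sup>2 + 2 * a + 2) (at_left 1)"
  proof -
    have "isCont F 1"
      by (rule DERIV_isCont[OF deriv]) simp
    then have "(F \<longlongrightarrow> F 1) (at_left 1)"
      by (simp add: isCont_def tendsto_within_subset[of _ _ _ UNIV])
    then show ?thesis
      by (simp add: one_ereal_def ereal_tendsto_simps F_def)
  qed
  note FTC = interval_integral_FTC_nonneg[of 0 1 F, OF _ deriv cont _ lim0 lim1]
  show "(LBINT t:{0<..<1}. (a - ln t)\<^sup>2) = a\<^sup>2 + 2 * a + 2"
    using FTC(2) by (simp add: LBINT_01)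
  show "set_integrable lborel {0<..<1} (\<lambda>t. (a - ln t)\<^sup>2)"
    using FTC(1) by (simp add: zero_ereal_def one_ereal_def)
qed

text \<open>
  The square of the majorant \<open>a - ln t\<close> with \<open>a = 14 / 33\<close> has integral \<open>a\<^sup>2 + 2 a + 2\<close>, which is less than
  \<open>3.03\<close>, and the claimed bound is \<open>3.13248\<close>.
\<close>

lemma digamma_gap_square_unit_integral:
  "set_integrable lborel {0<..<1} (\<lambda>t. (digamma_gap t)\<^sup>2)"
  "(LBINT t:{0<..<1}. (digamma_gap t)\<^sup>2) \<le> 2 * 1.56624"
proof -
  have le: "(digamma_gap t)\<^sup>2 \<le> (14 / 33 - ln t)\<^sup>2" if "t \<in> {0<..<1}" for t
    using that by (intro power_mono digamma_gap_le_log digamma_gap_nonneg) auto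
  have "set_borel_measurable borel {0<..<1} (\<lambda>t. (digamma_gap t)\<^sup>2)"
    by (intro set_measurable_continuous_on continuous_intros continuous_on_digamma_gap) auto
  then have "set_borel_measurable lborel {0<..<1} (\<lambda>t. (digamma_gap t)\<^sup>2)"
    by (simp add: set_borel_measurable_def)
  then show int: "set_integrable lborel {0<..<1} (\<lambda>t. (digamma_gap t)\<^sup>2)"
    by (rule set_integrable_bound[OF square_const_minus_ln_unit_integral(1)[of "14 / 33"]])
       (use le in auto)
  have "(LBINT t:{0<..<1}. (digamma_gap t)\<^sup>2) \<le> (LBINT t:{0<..<1}. (14 / 33 - ln t)\<^sup>2)"
    by (intro set_integral_mono int square_const_minus_ln_unit_integral le)
  also have "\<dots> \<le> 2 * 1.56624"
    unfolding square_const_minus_ln_unit_integral by (simp add: power2_eq_square)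
  finally show "(LBINT t:{0<..<1}. (digamma_gap t)\<^sup>2) \<le> 2 * 1.56624" .
qed

section \<open>Bounds for the Hardy integral\<close>

text \<open>
  Near \<open>0\<close> the integrand is dominated by the digamma gap itself, and away from \<open>0\<close> by the Gaussian,
  because there the gap is at most \<open>1\<close>. The two regions overlap so that their union is all of \<open>(0, \<infinity>)\<close>.
\<close>

lemma digamma_gap_gaussian_integrable:
  assumes "y > 0"
  shows "set_integrable lborel {0<..} (\<lambda>t. digamma_gap t * exp (- y * t\<^sup>2))"
proof -
  have meas: "set_borel_measurable lborel A (\<lambda>t. digamma_gap t * exp (- y * t\<^sup>2))"
    if "A \<subseteq> {0<..}" "A \<in> sets borel" for A
  proof -
    have "set_borel_measurable borel A (\<lambda>t. digamma_gap t * exp (- y * t\<^sup>2))"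
      using that by (intro set_measurable_continuous_on continuous_intros continuous_on_digamma_gap)
    then show ?thesis by (simp add: set_borel_measurable_def)
  qed
  have near_0: "set_integrable lborel {0<..<1} (\<lambda>t. digamma_gap t * exp (- y * t\<^sup>2))"
    by (rule set_integrable_bound[OF digamma_gap_unit_integral(1) meas])
       (use assms in \<open>auto simp: abs_mult intro!: mult_left_le\<close>)
  have away: "set_integrable lborel {1/2<..} (\<lambda>t. digamma_gap t * exp (- y * t\<^sup>2))"
  proof (rule set_integrable_bound[OF _ meas])
    show "set_integrable lborel {1/2<..} (\<lambda>t. exp (- y * t\<^sup>2))"
      by (rule set_integrable_subset[OF gaussian_half_line(1)[OF assms]]) auto
    have "\<bar>digamma_gap t\<bar> \<le> 1" if "t > 1/2" for t
    proof -
      have "digamma_gap t \<le> 1 / (2 * t)" "1 / (2 * t) \<le> 1" "0 \<le> digamma_gap t"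
        using that by (auto intro: digamma_gap_le digamma_gap_nonneg)
      then show ?thesis by linarith
    qed
    then show "AE t in lborel. t \<in> {1/2<..} \<longrightarrow>
        norm (digamma_gap t * exp (- y * t\<^sup>2)) \<le> norm (exp (- y * t\<^sup>2))"
      by (simp add: abs_mult)
  qed auto
  have "{0<..} = {0<..<1} \<union> {(1/2 :: real)<..}"
    by auto
  then show ?thesis
    using set_integrable_Un[OF near_0 away] by simp
qed

theorem theorem2p1:
  fixes y c1 c2 :: real
  assumes "y > 0"
    and "c1 = 0.952894"
    and "c2 = 1.56624"
  shows "2 * c1\<^sup>2 * sqrt y / (sqrt pi * erfi (sqrt y)) - Ei (- y) / 4 - exp (- y) / 12
             + sqrt (y * pi) / 12 * erfc (sqrt y) \<le> hardy_integral y
         \<and> hardy_integral y \<le> sqrt (c2 * sqrt (pi / (2 * y)) * erf (sqrt (2 * y))) - Ei (- y) / 4"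
proof -
  define h where "h = (\<lambda>t. digamma_gap t * exp (- y * t\<^sup>2))"
  define E where "E = (\<lambda>a::real. LBINT t:{0<..<1}. exp (a * t\<^sup>2))"
  have h: "set_integrable lborel {0<..} h"
    unfolding h_def by (rule digamma_gap_gaussian_integrable[OF assms(1)])
  have h_head: "set_integrable lborel {0<..<1} h" and h_tail: "set_integrable lborel {1<..} h"
    by (rule set_integrable_subset[OF h]; auto)+
  have hardy: "hardy_integral y = (LBINT t:{0<..<1}. h t) + (LBINT t:{1<..}. h t)"
    using set_integral_split_at_1[OF h]
    by (simp add: hardy_integral_def interval_lebesgue_integral_0_infty h_def digamma_gap_def)
  have int_exp: "set_integrable lborel {0<..<1} (\<lambda>t. exp (a * t\<^sup>2))" for a :: real
    by (intro set_integrable_unit_interval continuous_intros)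

  have head_ge: "2 * c1\<^sup>2 * sqrt y / (sqrt pi * erfi (sqrt y)) \<le> (LBINT t:{0<..<1}. h t)"
  proof -
    have "E (- y) \<le> (LBINT t:{0<..<1}. h t)"
    proof -
      have "antimono_on {0<..<1} digamma_gap"
        by (auto intro!: monotone_onI digamma_gap_antimono)
      moreover have "antimono_on {0..1} (\<lambda>t. exp (- y * t\<^sup>2))"
        using assms(1) by (auto intro!: monotone_onI power_mono)
      ultimately show ?thesis
        using chebyshev_unit_interval[of digamma_gap "\<lambda>t. exp (- y * t\<^sup>2)"]
          digamma_gap_unit_integral int_exp[of "- y"] h_head
        by (simp add: E_def h_def)
    qed
    moreover have "1 \<le> E (- y) * E y"
    proof -
      \<comment> \<open>The factors \<open>exp (- y t\<^sup>2 / 2)\<close> and \<open>exp (y t\<^sup>2 / 2)\<close> have product \<open>1\<close>.\<close>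
      have sq: "exp (a / 2 * t\<^sup>2) ^ 2 = exp (a * t\<^sup>2)" for a t :: real
        by (simp add: exp_double [symmetric] field_simps)
      have one: "exp (- y / 2 * t\<^sup>2) * exp (y / 2 * t\<^sup>2) = 1" for t
        by (simp add: exp_add [symmetric])
      show ?thesis
        using cauchy_schwarz_set_integral[of lborel "{0<..<1}" "\<lambda>t. exp (- y / 2 * t\<^sup>2)" "\<lambda>t. exp (y / 2 * t\<^sup>2)"]
        unfolding sq one using int_exp[of "- y"] int_exp[of y] int_exp[of 0]
        by (simp add: E_def set_integral_const)
    qed
    moreover have "E y > 0"
    proof -
      have "E y \<ge> 0"
        by (simp add: E_def set_lebesgue_integral_def)
      with \<open>1 \<le> E (- y) * E y\<close> show ?thesis
        by (cases "E y = 0") auto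
    qed
    moreover have "2 * c1\<^sup>2 * sqrt y / (sqrt pi * erfi (sqrt y)) = c1\<^sup>2 / E y"
    proof -
      have "erfi (sqrt y) = 2 / sqrt pi * sqrt y * E y"
        using erfi_sqrt[of y] assms(1) by (simp add: E_def)
      then show ?thesis
        using assms(1) \<open>E y > 0\<close> by (simp add: field_simps)
    qed
    moreover have "c1\<^sup>2 / E y \<le> 1 / E y"
    proof (rule divide_right_mono)
      show "c1\<^sup>2 \<le> 1"
        unfolding assms(2) by (simp add: power2_eq_square)
    qed (use \<open>E y > 0\<close> in simp)
    moreover have "1 / E y \<le> E (- y)"
      using \<open>1 \<le> E (- y) * E y\<close> \<open>E y > 0\<close> by (simp add: divide_le_eq)
    ultimately show ?thesis
      by linarith
  qed

  have head_le: "(LBINT t:{0<..<1}. h t) \<le> sqrt (c2 * sqrt (pi / (2 * y)) * erf (sqrt (2 * y)))"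
  proof -
    \<comment> \<open>The square of \<open>exp (- y t\<^sup>2)\<close> is why \<open>erf\<close> is taken at \<open>sqrt (2 y)\<close>.\<close>
    have sq: "exp (- y * t\<^sup>2) ^ 2 = exp (- (2 * y) * t\<^sup>2)" for t :: real
      by (simp add: exp_double [symmetric])
    have "(LBINT t:{0<..<1}. h t)\<^sup>2 \<le> (LBINT t:{0<..<1}. (digamma_gap t)\<^sup>2) * E (- (2 * y))"
      using cauchy_schwarz_set_integral[of lborel "{0<..<1}" digamma_gap "\<lambda>t. exp (- y * t\<^sup>2)"]
        digamma_gap_square_unit_integral(1) int_exp h_head
      unfolding sq h_def E_def by blast
    also have "\<dots> \<le> 2 * c2 * E (- (2 * y))"
    proof (rule mult_right_mono)
      show "(LBINT t:{0<..<1}. (digamma_gap t)\<^sup>2) \<le> 2 * c2"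
        using digamma_gap_square_unit_integral(2) assms(3) by simp
      show "0 \<le> E (- (2 * y))"
        by (simp add: E_def set_lebesgue_integral_def)
    qed
    also have "\<dots> = c2 * sqrt (pi / (2 * y)) * erf (sqrt (2 * y))"
      using assms(1) erf_sqrt[of "2 * y"]
      by (simp add: E_def real_sqrt_divide)
    finally show ?thesis by (rule real_le_rsqrt)
  qed

  note tail = gaussian_over_t_tail[OF assms(1)]
  note tail2 = gaussian_over_square_tail[OF assms(1)]
  have tail_le: "(LBINT t:{1<..}. h t) \<le> - Ei (- y) / 4"
  proof -
    have "(LBINT t:{1<..}. h t) \<le> (LBINT t:{1<..}. 1 / 2 * (exp (- y * t\<^sup>2) / t))"
    proof (intro set_integral_mono h_tail set_integrable_mult_right tail(1))
      fix t :: real assume "t \<in> {1<..}"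
      then have "h t \<le> 1 / (2 * t) * exp (- y * t\<^sup>2)"
        unfolding h_def by (intro mult_right_mono digamma_gap_le) auto
      then show "h t \<le> 1 / 2 * (exp (- y * t\<^sup>2) / t)" by simp
    qed
    also have "\<dots> = 1 / 2 * (LBINT t:{1<..}. exp (- y * t\<^sup>2) / t)"
      by (rule set_integral_mult_right)
    finally show ?thesis unfolding tail(2) by simp
  qed

  have tail_ge: "- Ei (- y) / 4 - exp (- y) / 12 + sqrt (y * pi) / 12 * erfc (sqrt y)
      \<le> (LBINT t:{1<..}. h t)"
  proof -
    have "(LBINT t:{1<..}. 1 / 2 * (exp (- y * t\<^sup>2) / t) - 1 / 12 * (exp (- y * t\<^sup>2) / t\<^sup>2))
        \<le> (LBINT t:{1<..}. h t)"
    proof (intro set_integral_mono set_integral_diff h_tail set_integrable_mult_right tail(1) tail2(1))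
      fix t :: real assume "t \<in> {1<..}"
      then have "(1 / (2 * t) - 1 / (12 * t\<^sup>2)) * exp (- y * t\<^sup>2) \<le> h t"
        unfolding h_def by (intro mult_right_mono digamma_gap_ge) auto
      then show "1 / 2 * (exp (- y * t\<^sup>2) / t) - 1 / 12 * (exp (- y * t\<^sup>2) / t\<^sup>2) \<le> h t"
        by (simp add: left_diff_distrib)
    qed
    also have "(LBINT t:{1<..}. 1 / 2 * (exp (- y * t\<^sup>2) / t) - 1 / 12 * (exp (- y * t\<^sup>2) / t\<^sup>2))
        = 1 / 2 * (- Ei (- y) / 2) - 1 / 12 * (exp (- y) - sqrt (y * pi) * erfc (sqrt y))"
      unfolding tail(2) [symmetric] tail2(2) [symmetric] set_integral_mult_right [symmetric]
      by (intro set_integral_diff set_integrable_mult_right tail(1) tail2(1))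
    finally show ?thesis by (simp add: field_simps)
  qed

  show ?thesis
    unfolding hardy using head_ge head_le tail_le tail_ge by linarith
qed

end
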